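(* In the setting described in the context (all-zero codeword transmitted over a BI-AWGN channel with fixed noise variance $\sigma^2>0$, code length $N=2^n$, nonempty information set $\mathscr{A}=\mathscr{A}_N\subset\{i: Z(W_N^{(i)})<2^{-N^\beta}\}$ for a fixed $\beta\in(\tfrac13,\tfrac12)$, perturbation power $\sigma_p^2\approx N^{-\alpha}$ for a fixed $\alpha\in(1-2\beta,\beta)$), let $\tau(0)$ and $\tau(1)$ be the first error positions of the SC decoder and of the $u$-side perturbation-enhanced SC decoder with one perturbation, respectively. Under the standing distributional assumptions listed in the context, $$\lim_{N\to\infty}\mathbb{P}\big(\tau(1)>\tau(0)\,\big|\,\tau(0)<N\big)=\frac12,$$ $$\lim_{N\to\infty}\mathbb{P}\big(\tau(1)=\tau(0)\,\big|\,\tau(0)<N\big)=\frac12.$$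
   Context: **Code and channel.** $N=2^n$; indices run over $\{0,\dots,N-1\}$. $W$ is the BI-AWGN channel: input bit $c$, output $y=(1-2c)+\text{noise}$, noise $\sim\mathscr{N}(0,\sigma^2)$, with $\sigma^2>0$ fixed. The Bhattacharyya parameter of a binary-input channel $W$ is $Z(W)=\int\sqrt{W(y|0)W(y|1)}\,dy$ (sum/integral over the output alphabet). Bit-channels are defined by $W_1^{(0)}=W$, $W_N^{(2i)}=(W_{N/2}^{(i)})^-$, $W_N^{(2i+1)}=(W_{N/2}^{(i)})^+$, where $V^-(y_1,y_2|u_1)=\frac12\sum_{u_2\in\{0,1\}}V(y_1|u_1\oplus u_2)V(y_2|u_2)$ and $V^+(y_1,y_2,u_1|u_2)=\frac12V(y_1|u_1\oplus u_2)V(y_2|u_2)$. **Parameters.** Fix $\beta\in(\frac13,\frac12)$ and $\alpha\in(1-2\beta,\beta)$. The perturbation power $\sigma_p^2=\sigma_p^2(N)>0$ satisfies $\sigma_p^2\approx N^{-\alpha}$, i.e. $\sigma_p^2N^{\alpha}\to1$ as $N\to\infty$. The information set $\mathscr{A}=\mathscr{A}_N$ is a nonempty subset of $\{i: Z(W_N^{(i)})<2^{-N^\beta}\}$. Indices not in $\mathscr{A}$ are frozen (value $0$) and always decoded correctly. **Means.** $\mu_i=\mu_N^{(i)}$ is defined by $\mu_1^{(0)}=2/\sigma^2$, $\mu_N^{(i)}=\phi^{-1}\big(1-(1-\phi(\mu_{N/2}^{(i/2)}))^2\big)$ for even $i$, and $\mu_N^{(i)}=2\mu_{N/2}^{((i-1)/2)}$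 for odd $i$, where $\phi(x)=1-\int_{-\infty}^\infty\frac{1}{\sqrt{4\pi x}}\tanh(\tfrac t2)e^{-(t-x)^2/(4x)}\,dt$ for $x>0$. It is a standing assumption (a consequence of the choice of $\mathscr{A}$) that $\mu_i\ge N^\beta$ for all $i\in\mathscr{A}$. **Perturbations.** $\sigma_i^2=2^{k_i}\sigma_p^2$, where $k_i$ is the number of $g$-operations on the $n$-layer SC decoding path to bit $i$, i.e. the number of ones in the binary expansion of $i$. $n_{u_i}\sim\mathscr{N}(0,\sigma_i^2)$ is the perturbation noise on bit $i$. **Decoders.** $L_i$ is the (random) decision log-likelihood ratio of bit $i$. The all-zero word is transmitted. For $i\in\mathscr{A}$, the SC decoder outputs $\hat u^{(0)}_i=1$ if $L_i<0$ and $0$ otherwise; the once-perturbed ($u$-side perturbation-enhanced) decoder outputs $\hat u^{(1)}_i=1$ if $L_i+n_{u_i}<0$ and $0$ otherwise. For $i\notin\mathscr{A}$, $\hat u_i^{(0)}=\hat u_i^{(1)}=0$. Write $\hat{\mathbf u}^{(t)}_{0:i}=(\hat u^{(t)}_0,\dots,\hat u^{(t)}_{i-1})$ and $\mathbf 0$ for an all-zero vector. The first error position is $\tau(t)=\min\{i:\hat u_i^{(t)}=1\}$, with $\tau(t)=N$ if there is no error, so $\{\tau(t)=i\}=\{\hat u_i^{(t)}=1,\hat{\mathbf u}^{(t)}_{0:i}=\mathbf 0\}$ for $i<N$. **Standing distributional assumptions.** For every $i\in\mathscr{A}$: 1. (Gaussian approximation) conditionally on $\hat{\mathbf u}^{(0)}_{0:i}=\mathbf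 0$, $L_i\sim\mathscr{N}(\mu_i,2\mu_i)$. 2. (Generalized Gaussian approximation) conditionally on $\hat{\mathbf u}^{(0)}_{0:i}=\mathbf 0$ and $\hat{\mathbf u}^{(1)}_{0:i}=\mathbf 0$, the pair $(L_i,L_i+n_{u_i})$ is distributed as $(G_1,G_1+G_2)$ with $G_1\sim\mathscr{N}(\mu_i,2\mu_i)$ and $G_2\sim\mathscr{N}(0,\sigma_i^2)$ independent. 3. For all sufficiently large $N$, all $j\in\mathscr{A}$ with $j<i$, and all Borel sets $A$, $\big|\mathbb{P}(L_i\in A\mid\hat{\mathbf u}^{(0)}_{0:i}=\mathbf 0,\hat{\mathbf u}^{(1)}_{0:j}=\mathbf 0)-\mathbb{P}(L_i\in A\mid\hat{\mathbf u}^{(0)}_{0:i}=\mathbf 0)\big|<2^{-N^\beta}$. *)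

theory Defs
  imports "HOL-Probability.Probability"
begin

text \<open>
  Bits are Booleans (\<open>True\<close> is the bit 1), so \<open>u \<noteq> v\<close> is addition modulo 2.
  A binary-input channel consists of a reference measure on its output alphabet and of the
  transition density \<open>W(y|c)\<close> with respect to that measure, written \<open>trans W y c\<close>.
\<close>

record 'y channel =
  out_measure :: "'y measure"
  trans :: "'y \<Rightarrow> bool \<Rightarrow> real"

definition bhattacharyya :: "'y channel \<Rightarrow> real" where
  "bhattacharyya W = (\<integral>y. sqrt (trans W y False * trans W y True) \<partial>out_measure W)"

definition minus_channel :: "'y channel \<Rightarrow> ('y \<times> 'y) channel" where
  "minus_channel V =
     \<lparr>out_measure = out_measure V \<Otimes>\<^sub>M out_measure V,
      trans = (\<lambda>(y1, y2) u1. 1/2 * (\<Sum>u2\<in>UNIV. trans V y1 (u1 \<noteq> u2) * trans V y2 u2))\<rparr>"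

definition plus_channel :: "'y channel \<Rightarrow> ('y \<times> 'y \<times> bool) channel" where
  "plus_channel V =
     \<lparr>out_measure = out_measure V \<Otimes>\<^sub>M (out_measure V \<Otimes>\<^sub>M count_space UNIV),
      trans = (\<lambda>(y1, y2, u1) u2. 1/2 * trans V y1 (u1 \<noteq> u2) * trans V y2 u2)\<rparr>"

definition bi_awgn :: "real \<Rightarrow> real channel" where
  "bi_awgn v = \<lparr>out_measure = lborel,
     trans = (\<lambda>y c. normal_density (1 - 2 * of_bool c) (sqrt v) y)\<rparr>"

text \<open>
  The output alphabet grows with each polarization step.  The datatype below
  contains all these alphabets, so that the bit-channels have a common type;
  \<open>relabel f\<close> renames the outputs of a channel along an injection \<open>f\<close>.
\<close>

datatype outcome = Obs real | Out_minus outcome outcome | Out_plus outcome outcome bool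

definition relabel :: "('y \<Rightarrow> 'z) \<Rightarrow> 'y channel \<Rightarrow> 'z channel" where
  "relabel f V = \<lparr>out_measure = embed_measure (out_measure V) f,
     trans = (\<lambda>z c. trans V (inv f z) c)\<rparr>"

text \<open>\<open>bit_channel W n i\<close> is the bit-channel with index \<open>i\<close> at length \<open>N = 2\<^sup>n\<close>.\<close>

fun bit_channel :: "real channel \<Rightarrow> nat \<Rightarrow> nat \<Rightarrow> outcome channel" where
  "bit_channel W 0 i = relabel Obs W"
| "bit_channel W (Suc n) i =
     (if even i
      then relabel (\<lambda>(y1, y2). Out_minus y1 y2) (minus_channel (bit_channel W n (i div 2)))
      else relabel (\<lambda>(y1, y2, u). Out_plus y1 y2 u) (plus_channel (bit_channel W n (i div 2))))"

definition phi :: "real \<Rightarrow> real" where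
  "phi x = 1 - (\<integral>t. 1 / sqrt (4 * pi * x) * tanh (t / 2) * exp (- (t - x)\<^sup>2 / (4 * x)) \<partial>lborel)"

definition phi_inv :: "real \<Rightarrow> real" where
  "phi_inv = the_inv_into {0<..} phi"

text \<open>\<open>llr_mean v n i\<close> is the mean \<open>\<mu>\<^sub>i\<close> at length \<open>N = 2\<^sup>n\<close> and noise variance \<open>v\<close>.\<close>

fun llr_mean :: "real \<Rightarrow> nat \<Rightarrow> nat \<Rightarrow> real" where
  "llr_mean v 0 i = 2 / v"
| "llr_mean v (Suc n) i =
     (if even i then phi_inv (1 - (1 - phi (llr_mean v n (i div 2)))\<^sup>2)
      else 2 * llr_mean v n (i div 2))"

definition ones :: "nat \<Rightarrow> nat" where
  "ones i = card {k. bit i k}"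

definition pert_var :: "real \<Rightarrow> nat \<Rightarrow> real" where
  "pert_var vp i = 2 ^ ones i * vp"

text \<open>The second parameter is the variance, not the standard deviation.\<close>

definition normal_law :: "real \<Rightarrow> real \<Rightarrow> real measure" where
  "normal_law m v = density lborel (normal_density m (sqrt v))"

definition cond_law ::
  "'w measure \<Rightarrow> ('w \<Rightarrow> bool) \<Rightarrow> 'y measure \<Rightarrow> ('w \<Rightarrow> 'y) \<Rightarrow> 'y measure" where
  "cond_law M E S X = distr (uniform_measure M {w \<in> space M. E w}) S X"

text \<open>
  Decoder outputs are random bit sequences: \<open>A\<close> is the information set, \<open>L i\<close> the decision
  log-likelihood ratio of bit \<open>i\<close> and \<open>P i\<close> the perturbation noise on bit \<open>i\<close>.
\<close>

definition sc_decoder :: "nat set \<Rightarrow> (nat \<Rightarrow> 'w \<Rightarrow> real) \<Rightarrow> nat \<Rightarrow> 'w \<Rightarrow> bool" where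
  "sc_decoder A L i w \<longleftrightarrow> i \<in> A \<and> L i w < 0"

definition perturbed_decoder ::
  "nat set \<Rightarrow> (nat \<Rightarrow> 'w \<Rightarrow> real) \<Rightarrow> (nat \<Rightarrow> 'w \<Rightarrow> real) \<Rightarrow> nat \<Rightarrow> 'w \<Rightarrow> bool" where
  "perturbed_decoder A L P i w \<longleftrightarrow> i \<in> A \<and> L i w + P i w < 0"

definition zero_before :: "(nat \<Rightarrow> 'w \<Rightarrow> bool) \<Rightarrow> nat \<Rightarrow> 'w \<Rightarrow> bool" where
  "zero_before u i w \<longleftrightarrow> (\<forall>j<i. \<not> u j w)"

definition first_error :: "nat \<Rightarrow> (nat \<Rightarrow> 'w \<Rightarrow> bool) \<Rightarrow> 'w \<Rightarrow> nat" where
  "first_error N u w = (if \<exists>i<N. u i w then LEAST i. u i w else N)"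

end

theory Submission
  imports Defs "HOL-Real_Asymp.Real_Asymp"
begin

text \<open>
  Let \<open>E\<^sub>i\<close> and \<open>F\<^sub>i\<close> be the events that the SC decoder, respectively the perturbed decoder,
  makes no error before bit \<open>i\<close>, and let \<open>q\<^sub>i\<close> be the probability that a
  \<open>\<N>(\<mu>\<^sub>i, 2\<mu>\<^sub>i)\<close> variable is negative. Then \<open>P(\<tau>(0) = i) = P(E\<^sub>i) q\<^sub>i\<close> and
  \<open>P(\<tau>(0) = \<tau>(1) = i) = P(E\<^sub>i \<inter> F\<^sub>i) P(G\<^sub>1 < 0, G\<^sub>1 + G\<^sub>2 < 0)\<close>.
  Since the minus step of the mean recursion decreases the mean and the plus step doubles it,
  \<open>2\<close> to the number of plus steps is at least of order \<open>\<mu>\<^sub>i \<ge> N\<^sup>\<beta>\<close>, so that \<open>\<sigma>\<^sub>i\<^sup>2\<close> is at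
  least of order \<open>N\<^bsup>\<beta> - \<alpha>\<^esup>\<close> and tends to infinity. On the other hand, \<open>G\<^sub>1\<close> given \<open>G\<^sub>1 < 0\<close> is of
  bounded size, so the sign of \<open>G\<^sub>1 + G\<^sub>2\<close> is asymptotically a fair coin. Finally,
  \<open>\<sigma>\<^sub>i\<^sup>2\<close> is at most of order \<open>N\<^bsup>1 - \<alpha>\<^esup>\<close>, so the union bound over all error events decays like
  \<open>N exp (- c N\<^bsup>\<delta>\<^esup>)\<close> with \<open>\<delta> = min \<beta> (2\<beta> - 1 + \<alpha>) > 0\<close>, and \<open>P(E\<^sub>i \<inter> F\<^sub>i)\<close> tends to \<open>1\<close>
  uniformly in \<open>i\<close>.
\<close>

section \<open>The recursion for the means\<close>

text \<open>Splitting off the last binary digit puts \<open>ones\<close> on the recursion through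
  \<open>i div 2\<close> that \<open>llr_mean\<close> follows.\<close>

lemma ones_rec: "ones i = ones (i div 2) + i mod 2"
proof -
  \<comment> \<open>Additivity of \<open>card\<close> over the disjoint union below needs finite
    digit sets; a digit at place \<open>k\<close> forces \<open>k < j\<close> because
    \<open>j < 2 ^ j\<close>.\<close>
  have fin: "finite {k. bit j k}" for j :: nat
  proof (rule finite_subset)
    have "k < j" if "bit j k" for k
    proof (rule ccontr)
      assume "\<not> k < j"
      then have "j < 2 ^ k" using less_exp[of j] power_increasing[of j k "2::nat"] by linarith
      then show False using that by (simp add: bit_iff_odd)
    qed
    then show "{k. bit j k} \<subseteq> {..<j}" by auto
  qed simp
  have "{k. bit i k} = Suc ` {k. bit (i div 2) k} \<union> (if odd i then {0} else {})"
    (is "?A = ?B \<union> ?C")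
  proof (intro set_eqI)
    fix k show "k \<in> ?A \<longleftrightarrow> k \<in> ?B \<union> ?C"
      by (cases k) (auto simp: bit_0 bit_Suc)
  qed
  moreover have "card (?B \<union> ?C) = card ?B + card ?C"
    by (rule card_Un_disjoint) (auto simp: fin)
  ultimately show ?thesis
    by (auto simp: ones_def card_image odd_iff_mod_2_eq_one)
qed

lemma ones_le: "i < 2 ^ n \<Longrightarrow> ones i \<le> n"
proof (induction n arbitrary: i)
  case 0
  then show ?case by (simp add: ones_def)
next
  case (Suc n)
  have "ones (i div 2) \<le> n" using Suc by auto
  moreover have "i mod 2 \<le> 1" by simp
  ultimately show ?case using ones_rec[of i] by linarith
qed

text \<open>Completing the square in the Gaussian integral gives
  \<open>phi x = exp (- x / 4) * E (1 / cosh (sqrt (x / 2) * Z))\<close> with \<open>Z\<close> standard normal.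
  In this form monotonicity and continuity are immediate.\<close>

definition phi_ext :: "real \<Rightarrow> real" where
  "phi_ext x = exp (- x / 4) * (\<integral>z. std_normal_density z / cosh (sqrt (x / 2) * z) \<partial>lborel)"

text \<open>Since \<open>cosh\<close> is at least 1, the normal density dominates the integrand of
  \<open>phi_ext\<close>. This gives integrability and later the majorant for dominated
  convergence.\<close>

lemma normal_over_cosh_le: "norm (std_normal_density z / cosh y) \<le> std_normal_density z" for y :: real
  using mult_left_mono[OF cosh_real_ge_1[of y] normal_density_nonneg[of 0 1 z]]
  by (simp add: divide_le_eq)

lemma integrable_normal_over_cosh:
  "integrable lborel (\<lambda>z. std_normal_density z / cosh (c * z))"
proof (rule Bochner_Integration.integrable_bound)
  show "integrable lborel (normal_density 0 1)" by simp
  have "(\<lambda>z. std_normal_density z / cosh (c * z)) \<in> borel_measurable borel"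
    unfolding normal_density_def
    by (intro borel_measurable_continuous_onI continuous_intros) auto
  then show "(\<lambda>z. std_normal_density z / cosh (c * z)) \<in> borel_measurable lborel" by simp
qed (use normal_over_cosh_le in auto)

lemma one_minus_tanh_half: "1 - tanh (t / 2) = exp (- t / 2) / cosh (t / 2)" for t :: real
proof -
  have "cosh (t/2) - sinh (t/2) = exp (- t/2)"
    by (simp add: cosh_minus_sinh)
  moreover have "cosh (t/2) \<noteq> (0::real)" by simp
  ultimately show ?thesis by (simp add: tanh_def field_simps)
qed

lemma phi_eq_phi_ext:
  assumes x: "x > 0"
  shows "phi x = phi_ext x"
proof -
  let ?s = "sqrt (2 * x)"
  let ?f = "\<lambda>t. normal_density x ?s t"
  have s: "?s > 0" "?s\<^sup>2 = 2 * x" using x by auto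
  have dens: "1 / sqrt (4 * pi * x) * tanh (t / 2) * exp (- (t - x)\<^sup>2 / (4 * x)) = ?f t * tanh (t / 2)" for t
    using s by (simp add: normal_density_def algebra_simps)
  have tanh_le: "\<bar>tanh y\<bar> \<le> 1" for y :: real
    using tanh_real_bounds[of y] by auto
  have tanh_meas: "(\<lambda>t::real. tanh (t/2)) \<in> borel_measurable borel"
    by (intro borel_measurable_continuous_onI continuous_intros) auto
  have int: "integrable lborel (\<lambda>t. ?f t * tanh (t / 2))"
  proof (rule Bochner_Integration.integrable_bound)
    show "integrable lborel (normal_density x ?s)" using s by simp
    show "(\<lambda>t. ?f t * tanh (t / 2)) \<in> borel_measurable lborel"
      using tanh_meas by simp
    show "AE t in lborel. norm (?f t * tanh (t / 2)) \<le> norm (?f t)"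
      by (auto simp: abs_mult intro!: mult_left_le tanh_le)
  qed
    \<comment> \<open>The leading 1 in \<open>phi\<close> is written as the total mass of the normal
      density, so that \<open>1 - tanh (t / 2)\<close> appears under one integral.\<close>
    have "phi x = (\<integral>t. ?f t - ?f t * tanh (t / 2) \<partial>lborel)"
    unfolding phi_def dens using s by (subst Bochner_Integration.integral_diff[OF _ int]) auto
  also have "\<dots> = (\<integral>t. exp (- x / 4) * (normal_density 0 ?s t / cosh (t / 2)) \<partial>lborel)"
  proof (intro Bochner_Integration.integral_cong refl)
    fix t
    \<comment> \<open>The factor \<open>exp (- t / 2)\<close> coming from
      \<open>1 - tanh (t / 2)\<close> cancels the linear term of the square, which recentres the
      Gaussian at 0 and leaves \<open>exp (- x / 4)\<close>.\<close>
    have "- (t - x)\<^sup>2 / (4 * x) + - t / 2 = - x / 4 + - t\<^sup>2 / (4 * x)"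
      using x by (simp add: field_simps power2_eq_square)
    then have e: "exp (- (t - x)\<^sup>2 / (4 * x)) * exp (- t / 2) = exp (- x / 4) * exp (- t\<^sup>2 / (4 * x))"
      by (simp flip: exp_add)
    have "?f t - ?f t * tanh (t / 2) = ?f t * (1 - tanh (t / 2))" by (simp add: algebra_simps)
    also have "\<dots> = 1 / sqrt (2 * pi * ?s\<^sup>2) * (exp (- (t - x)\<^sup>2 / (4 * x)) * exp (- t / 2)) / cosh (t / 2)"
      unfolding one_minus_tanh_half normal_density_def using s by simp
    also have "\<dots> = exp (- x / 4) * (normal_density 0 ?s t / cosh (t / 2))"
      unfolding e normal_density_def using s by simp
    finally show "?f t - ?f t * tanh (t / 2) = exp (- x / 4) * (normal_density 0 ?s t / cosh (t / 2))" .
  qed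
  also have "\<dots> = exp (- x / 4) * (\<integral>t. normal_density 0 ?s t / cosh (t / 2) \<partial>lborel)"
    by (rule integral_mult_right_zero)
  also have "(\<integral>t. normal_density 0 ?s t / cosh (t / 2) \<partial>lborel)
      = (\<integral>z. ?s * (normal_density 0 ?s (?s * z) / cosh (?s * z / 2)) \<partial>lborel)"
    unfolding integral_mult_right_zero
    using s lborel_integral_real_affine[of ?s "\<lambda>t. normal_density 0 ?s t / cosh (t / 2)" 0] by simp
  also have "\<dots> = (\<integral>z. std_normal_density z / cosh (sqrt (x / 2) * z) \<partial>lborel)"
  proof (intro Bochner_Integration.integral_cong refl)
    fix z
    have "?s / 2 = sqrt (x / 2)"
      by (rule real_sqrt_unique[symmetric]) (use x in \<open>auto simp: power_divide\<close>)
    then have c: "?s * z / 2 = sqrt (x / 2) * z" by (metis times_divide_eq_left)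
    have "?s * normal_density 0 ?s (?s * z) = std_normal_density z"
      using x s by (simp add: normal_density_def power_mult_distrib real_sqrt_mult field_simps)
    then show "?s * (normal_density 0 ?s (?s * z) / cosh (?s * z / 2)) = std_normal_density z / cosh (sqrt (x / 2) * z)"
      unfolding c by simp
  qed
  finally show ?thesis by (simp add: phi_ext_def)
qed

lemma phi_ext_0: "phi_ext 0 = 1"
  by (simp add: phi_ext_def)

lemma phi_ext_pos: "phi_ext x > 0"
proof -
  let ?f = "\<lambda>z. std_normal_density z / cosh (sqrt (x / 2) * z)"
  have pos: "?f z > 0" for z by (simp add: normal_density_pos)
  have "integral\<^sup>L lborel ?f \<noteq> 0"
  proof
    assume "integral\<^sup>L lborel ?f = 0"
    then have "AE z in lborel. ?f z = 0"
      using integral_nonneg_eq_0_iff_AE[OF integrable_normal_over_cosh] pos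
      by (auto simp: less_imp_le)
    then have "AE z in (lborel :: real measure). False"
      by eventually_elim (use pos in \<open>metis less_irrefl\<close>)
    then show False by (simp add: ae_filter_eq_bot_iff eventually_False)
  qed
  moreover have "integral\<^sup>L lborel ?f \<ge> 0"
    by (rule Bochner_Integration.integral_nonneg) (rule less_imp_le[OF pos])
  ultimately have "integral\<^sup>L lborel ?f > 0" by linarith
  then show ?thesis unfolding phi_ext_def by (intro mult_pos_pos) auto
qed

text \<open>The integral factor decreases weakly, because \<open>cosh\<close> grows with the
  absolute value of its argument; strictness comes from the factor
  \<open>exp (- x / 4)\<close>.\<close>

lemma phi_ext_less:
  assumes "0 \<le> x" "x < y"
  shows "phi_ext y < phi_ext x"
proof -
  have "(\<integral>z. std_normal_density z / cosh (sqrt (y / 2) * z) \<partial>lborel)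
      \<le> (\<integral>z. std_normal_density z / cosh (sqrt (x / 2) * z) \<partial>lborel)" (is "?I y \<le> ?I x")
  proof (intro integral_mono integrable_normal_over_cosh divide_left_mono)
    fix z :: real
    have "cosh \<bar>sqrt (x / 2) * z\<bar> \<le> cosh \<bar>sqrt (y / 2) * z\<bar>"
      using assms by (subst cosh_real_nonneg_le_iff) (auto simp: abs_mult mult_right_mono)
    then show "cosh (sqrt (x / 2) * z) \<le> cosh (sqrt (y / 2) * z)"
      by (simp add: cosh_real_abs)
  qed auto
  moreover have "?I x > 0"
    using phi_ext_pos[of x] by (simp add: phi_ext_def zero_less_mult_iff)
  ultimately show ?thesis
    unfolding phi_ext_def using assms phi_ext_pos[of y]
    by (intro mult_less_le_imp_less) (auto simp: phi_ext_def zero_less_mult_iff)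
qed

lemma continuous_on_phi_ext: "continuous_on S phi_ext"
proof -
  have "(\<lambda>n. \<integral>z. std_normal_density z / cosh (sqrt (u n / 2) * z) \<partial>lborel) 
      \<longlonglongrightarrow> (\<integral>z. std_normal_density z / cosh (sqrt (a / 2) * z) \<partial>lborel)"
    if "u \<longlonglongrightarrow> a" for u a
  proof (rule integral_dominated_convergence)
    show "integrable lborel (normal_density 0 1)" by simp
    show "AE z in lborel. (\<lambda>n. std_normal_density z / cosh (sqrt (u n / 2) * z)) 
       \<longlonglongrightarrow> std_normal_density z / cosh (sqrt (a / 2) * z)"
      by (intro AE_I2 tendsto_intros that) auto
    show "AE z in lborel. norm (std_normal_density z / cosh (sqrt (u n / 2) * z)) \<le> std_normal_density z" for n
      by (rule AE_I2) (rule normal_over_cosh_le)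
  qed (use integrable_normal_over_cosh borel_measurable_integrable in blast)+
  then show ?thesis
    unfolding phi_ext_def[abs_def]
    by (intro continuous_at_imp_continuous_on ballI continuous_intros)
       (auto simp: continuous_at_sequentially o_def)
qed

text \<open>For \<open>p = phi m\<close> in (0, 1) the value \<open>1 - (1 - p)\<^sup>2\<close> lies
  in [p, 1). As \<open>phi\<close> is decreasing, its preimage is at most \<open>m\<close>: a minus
  step never increases the mean.\<close>

lemma phi_inv_minus_step:
  assumes m: "m > 0"
  shows "phi_inv (1 - (1 - phi m)\<^sup>2) \<in> {0<..m}"
proof -
  define y where "y = 1 - (1 - phi m)\<^sup>2"
  have p: "phi m = phi_ext m" "0 < phi m" "phi m < 1"
    using m phi_eq_phi_ext phi_ext_pos phi_ext_less[of 0 m] phi_ext_0 by auto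
  have "(1 - phi m)\<^sup>2 \<le> 1 - phi m" "0 < (1 - phi m)\<^sup>2"
    using p by (auto simp: power2_eq_square mult_left_le)
  then have y: "phi_ext m \<le> y" "y < 1" using p by (auto simp: y_def)
  \<comment> \<open>The intermediate value theorem is applied to \<open>phi_ext\<close> on [0, m],
    whose value 1 at the left end lies above \<open>y\<close>; \<open>y < 1\<close> then excludes
    \<open>x = 0\<close>.\<close>
  obtain x where x: "0 \<le> x" "x \<le> m" "phi_ext x = y"
    using IVT2'[of phi_ext m y 0] y m continuous_on_phi_ext phi_ext_0 by auto
  then have "x \<noteq> 0" using y phi_ext_0 by auto
  then have x0: "x > 0" using x by simp
  have "inj_on phi {0<..}"
  proof (rule linorder_inj_onI)
    fix x y :: real assume "x < y" "x \<in> {0<..}" "y \<in> {0<..}"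
    then show "phi x \<noteq> phi y" using phi_ext_less[of x y] by (simp add: phi_eq_phi_ext)
  qed auto
  then have "the_inv_into {0<..} phi y = x"
    using x x0 by (intro the_inv_into_f_eq) (auto simp: phi_eq_phi_ext)
  then show ?thesis using x x0 by (simp add: phi_inv_def y_def)
qed

text \<open>A plus step doubles both the mean and \<open>2 ^ ones i\<close>; a minus step keeps
  \<open>ones i\<close> and does not increase the mean. Read backwards, a large mean forces many
  ones, hence a large perturbation variance.\<close>

lemma llr_mean_bounds:
  assumes "v > 0"
  shows "0 < llr_mean v n i \<and> llr_mean v n i \<le> 2 ^ ones i * (2 / v)"
proof (induction n arbitrary: i)
  case 0
  \<comment> \<open>The induction runs over arbitrary \<open>i\<close>, so at length 1 only
    \<open>1 \<le> 2 ^ ones i\<close> is available.\<close>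
  have "1 * (2 / v) \<le> 2 ^ ones i * (2 / v)"
    using assms by (intro mult_right_mono) auto
  then show ?case using assms by simp
next
  case (Suc n)
  let ?m = "llr_mean v n (i div 2)"
  note IH = Suc[of "i div 2"]
  show ?case
  proof (cases "even i")
    case True
    then have "ones i = ones (i div 2)" by (subst ones_rec) auto
    then show ?thesis using phi_inv_minus_step[of ?m] IH True by auto
  next
    case False
    then have "ones i = Suc (ones (i div 2))" by (subst ones_rec) (auto simp: odd_iff_mod_2_eq_one)
    then show ?thesis using IH False by auto
  qed
qed

section \<open>Gaussian estimates\<close>

lemma prob_space_normal_law: "v > 0 \<Longrightarrow> prob_space (normal_law m v)"
  unfolding normal_law_def by (rule prob_space_normal_density) auto

lemma sets_normal_law [simp, measurable_cong]: "sets (normal_law m v) = sets borel"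
  by (simp add: normal_law_def)

lemma space_normal_law [simp]: "space (normal_law m v) = UNIV"
  by (simp add: normal_law_def)

lemma measure_normal_law:
  assumes "B \<in> sets borel"
  shows "measure (normal_law m v) B = (\<integral>x. normal_density m (sqrt v) x * indicator B x \<partial>lborel)"
proof -
  have "measure (normal_law m v) B
      = enn2real (\<integral>\<^sup>+x. ennreal (normal_density m (sqrt v) x * indicator B x) \<partial>lborel)"
    using assms by (simp add: measure_def normal_law_def emeasure_density ennreal_mult' flip: ennreal_indicator)
  also have "\<dots> = (\<integral>x. normal_density m (sqrt v) x * indicator B x \<partial>lborel)"
    using assms by (intro integral_eq_nn_integral[symmetric]) auto
  finally show ?thesis .
qed

lemma integrable_normal_indicator:
  "v > 0 \<Longrightarrow> B \<in> sets borel \<Longrightarrow>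
    integrable lborel (\<lambda>x. normal_density m (sqrt v) x * indicator B x)"
  by (rule integrable_real_mult_indicator) auto

text \<open>For \<open>t < x \<le> m\<close> the squared distance from \<open>t\<close> to
  \<open>m\<close> is at least the sum of those from \<open>t\<close> to \<open>x\<close> and from
  \<open>x\<close> to \<open>m\<close>. So the density is at most the exponential factor times the
  density recentred at \<open>x\<close>, which has mass 1.\<close>

lemma measure_normal_law_lower_tail:
  assumes "v > 0" "x \<le> m"
  shows "measure (normal_law m v) {..<x} \<le> exp (- (m - x)\<^sup>2 / (2 * v))"
proof -
  let ?c = "exp (- (m - x)\<^sup>2 / (2 * v))"
  have "measure (normal_law m v) {..<x}
      \<le> (\<integral>t. ?c * normal_density x (sqrt v) t \<partial>lborel)"
    unfolding measure_normal_law[of "{..<x}", simplified]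
  proof (intro integral_mono)
    fix t
    show "normal_density m (sqrt v) t * indicator {..<x} t \<le> ?c * normal_density x (sqrt v) t"
    proof (cases "t < x")
      case True
      have "0 \<le> 2 * ((m - x) * (x - t))" using assms True by simp
      then have "- (t - m)\<^sup>2 \<le> - (m - x)\<^sup>2 + - (t - x)\<^sup>2"
        by (simp add: power2_eq_square algebra_simps)
      then have "- (t - m)\<^sup>2 / (2 * v) \<le> - (m - x)\<^sup>2 / (2 * v) + - (t - x)\<^sup>2 / (2 * v)"
        using assms unfolding add_divide_distrib[symmetric] by (intro divide_right_mono) auto
      then have "exp (- (t - m)\<^sup>2 / (2 * v)) \<le> ?c * exp (- (t - x)\<^sup>2 / (2 * v))"
        by (simp flip: exp_add)
      then have "1 / sqrt (2 * pi * v) * exp (- (t - m)\<^sup>2 / (2 * v))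
          \<le> 1 / sqrt (2 * pi * v) * (?c * exp (- (t - x)\<^sup>2 / (2 * v)))"
        using assms by (intro mult_left_mono) auto
      then show ?thesis
        using assms True by (simp add: normal_density_def mult_ac)
    qed simp
  qed (use assms in \<open>auto intro: integrable_normal_indicator\<close>)
  also have "\<dots> = ?c" using assms by simp
  finally show ?thesis .
qed

lemma measure_normal_law_negative: 
  assumes "v > 0"
  shows "measure (normal_law 0 v) {..<0} = 1/2"
proof -
  interpret prob_space "normal_law 0 v" by (rule prob_space_normal_law[OF assms])
  let ?f = "\<lambda>x. normal_density 0 (sqrt v) x * indicator {..<0} x"
  have "measure (normal_law 0 v) {..<0} = (\<integral>x. ?f (0 + (-1) * x) \<partial>lborel)"
    unfolding measure_normal_law[of "{..<0}", simplified]
    by (subst lborel_integral_real_affine[of "-1" _ 0]) auto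
  also have "\<dots> = measure (normal_law 0 v) {0<..}"
    unfolding measure_normal_law[of "{0<..}", simplified]
    by (intro Bochner_Integration.integral_cong) (auto simp: normal_density_def indicator_def)
  finally have sym: "measure (normal_law 0 v) {..<0} = measure (normal_law 0 v) {0<..}" .
  \<comment> \<open>Reflection makes the two open half-lines equally likely; they carry total mass 1
    because the point 0 is null.\<close>
  have "measure (normal_law 0 v) {0} = integral\<^sup>L lborel (\<lambda>x::real. 0)"
    unfolding measure_normal_law[OF borel_singleton[OF sets.empty_sets]]
  proof (rule Bochner_Integration.integral_cong_AE)
    show "AE x in lborel. normal_density 0 (sqrt v) x * indicator {0} x = 0"
      using AE_lborel_singleton[of 0] by eventually_elim auto
  qed auto
  then have "measure (normal_law 0 v) {0} = 0" by simp
  moreover have "measure (normal_law 0 v) ({..<0} \<union> {0} \<union> {0<..}) 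
    = measure (normal_law 0 v) {..<0} + measure (normal_law 0 v) {0} + measure (normal_law 0 v) {0<..}"
    by (subst finite_measure_Union, (auto simp: ivl_disj_un_one)[3])+ simp
  moreover have "{..<0} \<union> {0} \<union> {0<..} = (UNIV :: real set)" by auto
  moreover have "measure (normal_law 0 v) UNIV = 1" using prob_space by simp
  ultimately show ?thesis using sym by simp
qed

text \<open>The density never exceeds \<open>1 / sqrt v\<close>, so a wide Gaussian puts little mass
  on any fixed interval.\<close>

lemma measure_normal_law_interval_le:
  assumes "v > 0" "K \<ge> 0"
  shows "measure (normal_law m v) {x..<x + K} \<le> K / sqrt v"
proof -
  have "measure (normal_law m v) {x..<x + K} \<le> (\<integral>t. 1 / sqrt v * indicator {x..<x + K} t \<partial>lborel)"
    unfolding measure_normal_law[of "{x..<x + K}", simplified]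
  proof (intro integral_mono mult_right_mono)
    fix t
    have "1 * sqrt v \<le> sqrt (2 * pi) * sqrt v"
      using pi_gt3 assms by (intro mult_right_mono) (auto simp: real_le_rsqrt)
    moreover have "exp (- (t - m)\<^sup>2 / (2 * v)) \<le> 1" using assms by simp
    ultimately have "exp (- (t - m)\<^sup>2 / (2 * v)) / sqrt (2 * pi * v) \<le> 1 / sqrt v"
      using assms by (intro frac_le) (auto simp: real_sqrt_mult)
    then show "normal_density m (sqrt v) t \<le> 1 / sqrt v"
      using assms by (simp add: normal_density_def)
  qed (use assms in \<open>auto intro: integrable_normal_indicator\<close>)
  also have "\<dots> = K / sqrt v" using assms by simp
  finally show ?thesis .
qed

lemma measure_normal_law_pos:
  assumes "v > 0"
  shows "measure (normal_law m v) {..<x} > 0"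
proof -
  let ?f = "\<lambda>t. normal_density m (sqrt v) t * indicator {..<x} t"
  have "measure (normal_law m v) {..<x} \<noteq> 0"
  proof
    assume "measure (normal_law m v) {..<x} = 0"
    then have "integral\<^sup>L lborel ?f = 0"
      unfolding measure_normal_law[of "{..<x}", simplified] .
    then have "AE t in lborel. ?f t = 0"
      using integral_nonneg_eq_0_iff_AE[OF integrable_normal_indicator[OF assms, of "{..<x}"]] by auto
    then have "AE t in lborel. t \<notin> {..<x}"
      by eventually_elim (use normal_density_pos[of "sqrt v" m] assms in \<open>auto simp: indicator_def less_le split: if_splits\<close>)
    then have "{..<x} \<in> null_sets lborel" by (subst AE_iff_null_sets) auto
    then have "{x - 1..<x} \<in> null_sets lborel" by (rule null_sets_subset) auto
    then show False by (simp add: null_sets_def)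
  qed
  then show ?thesis by (simp add: zero_less_measure_iff)
qed

text \<open>Under \<open>\<N>(m, 2m)\<close> the density at \<open>t - K\<close> is at most \<open>exp (- K / 2)\<close> times the density
  at \<open>t < 0\<close>, so the error magnitude does not grow with \<open>m\<close>.\<close>

lemma measure_normal_law_shifted_tail:
  assumes "m > 0" "K \<ge> 0"
  shows "measure (normal_law m (2 * m)) {..<- K}
    \<le> exp (- K / 2) * measure (normal_law m (2 * m)) {..<0}"
proof -
  let ?s = "sqrt (2 * m)"
  let ?f = "\<lambda>t. normal_density m ?s t * indicator {..<- K} t"
  have "measure (normal_law m (2 * m)) {..<- K} = (\<integral>t. ?f (- K + 1 * t) \<partial>lborel)"
    unfolding measure_normal_law[of "{..<- K}", simplified]
    by (subst lborel_integral_real_affine[of 1 _ "-K"]) auto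
  also have "\<dots> \<le> (\<integral>t. exp (- K / 2) * (normal_density m ?s t * indicator {..<0} t) \<partial>lborel)"
  proof (rule integral_mono)
    show "integrable lborel (\<lambda>t. ?f (- K + 1 * t))"
      by (rule lborel_integrable_real_affine) (use assms in \<open>auto intro: integrable_normal_indicator\<close>)
    show "integrable lborel (\<lambda>t. exp (- K / 2) * (normal_density m ?s t * indicator {..<0} t))"
      using assms by (intro integrable_mult_right integrable_normal_indicator) auto
    fix t
    show "?f (- K + 1 * t) \<le> exp (- K / 2) * (normal_density m ?s t * indicator {..<0} t)"
    proof (cases "t < 0")
      case True
      \<comment> \<open>Divided by \<open>4 * m\<close>, the cross term \<open>- 2 * K * m\<close>
        gives \<open>- K / 2\<close> whatever \<open>m\<close> is, since the variance is twice the
        mean; the last bracket is nonpositive for \<open>t < 0\<close>.\<close>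
      have "- (t - K - m)\<^sup>2 = - 2 * K * m + - (t - m)\<^sup>2 + (2 * K * t - K\<^sup>2)"
        by (simp add: power2_eq_square algebra_simps)
      moreover have "2 * K * t - K\<^sup>2 \<le> 0"
        using True assms by (smt (verit) mult_nonneg_nonpos zero_le_power2)
      ultimately have "- (t - K - m)\<^sup>2 \<le> - 2 * K * m + - (t - m)\<^sup>2" by linarith
      then have "- (t - K - m)\<^sup>2 / (4 * m) \<le> (- 2 * K * m + - (t - m)\<^sup>2) / (4 * m)"
        using assms by (intro divide_right_mono) auto
      also have "\<dots> = - K / 2 + - (t - m)\<^sup>2 / (4 * m)"
        using assms by (simp add: field_simps)
      finally have "exp (- (t - K - m)\<^sup>2 / (4 * m)) \<le> exp (- K / 2) * exp (- (t - m)\<^sup>2 / (4 * m))"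
        by (simp flip: exp_add)
      then have "1 / sqrt (4 * pi * m) * exp (- (t - K - m)\<^sup>2 / (4 * m))
          \<le> 1 / sqrt (4 * pi * m) * (exp (- K / 2) * exp (- (t - m)\<^sup>2 / (4 * m)))"
        using assms by (intro mult_left_mono) auto
      then show ?thesis
        using assms True by (simp add: normal_density_def algebra_simps)
    qed auto
  qed
  also have "\<dots> = exp (- K / 2) * measure (normal_law m (2 * m)) {..<0}"
    unfolding measure_normal_law[of "{..<0}", simplified] by (rule integral_mult_right_zero)
  finally show ?thesis .
qed

lemma measure_pair_Times:
  assumes "prob_space Q" "A \<in> sets P" "B \<in> sets Q"
  shows "measure (P \<Otimes>\<^sub>M Q) (A \<times> B) = measure P A * measure Q B"
proof -
  interpret prob_space Q by fact
  show ?thesis using assms by (simp add: measure_def emeasure_pair_measure_Times enn2real_mult)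
qed

section \<open>The joint law of a decision LLR and an independent perturbation\<close>

locale perturbed_llr =
  fixes m s :: real
  assumes mean_pos: "m > 0" and var_pos: "s > 0"
begin

abbreviation "llr_law \<equiv> normal_law m (2 * m)"
abbreviation "pert_law \<equiv> normal_law 0 s"
abbreviation "joint_law \<equiv> llr_law \<Otimes>\<^sub>M pert_law"

sublocale llr: prob_space llr_law using mean_pos by (intro prob_space_normal_law) auto
sublocale pert: prob_space pert_law using var_pos by (intro prob_space_normal_law) auto
sublocale pair_prob_space llr_law pert_law ..

lemma joint_Times:
  "A \<in> sets borel \<Longrightarrow> B \<in> sets borel \<Longrightarrow> measure joint_law (A \<times> B) = measure llr_law A * measure pert_law B"
  by (rule measure_pair_Times) (auto intro: pert.prob_space_axioms)

lemma sets_joint_law [measurable_cong]: "sets joint_law = sets (borel \<Otimes>\<^sub>M borel)"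
  by (intro sets_pair_measure_cong) auto

lemma joint_meas [measurable]:
  "{(a, b). a < 0 \<and> a + b < 0} \<in> sets (borel \<Otimes>\<^sub>M (borel :: real measure))"
  "{(a, b). a < 0 \<or> a + b < 0} \<in> sets (borel \<Otimes>\<^sub>M (borel :: real measure))"
  "{(a, b). a < 0 \<and> a + b \<ge> 0} \<in> sets (borel \<Otimes>\<^sub>M (borel :: real measure))"
proof -
  have "{p \<in> space (borel \<Otimes>\<^sub>M borel). fst p < 0 \<and> fst p + snd p < (0::real)} \<in> sets (borel \<Otimes>\<^sub>M borel)"
    "{p \<in> space (borel \<Otimes>\<^sub>M borel). fst p < 0 \<or> fst p + snd p < (0::real)} \<in> sets (borel \<Otimes>\<^sub>M borel)"
    "{p \<in> space (borel \<Otimes>\<^sub>M borel). fst p < 0 \<and> fst p + snd p \<ge> (0::real)} \<in> sets (borel \<Otimes>\<^sub>M borel)"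
    by measurable
  then show
    "{(a, b). a < 0 \<and> a + b < 0} \<in> sets (borel \<Otimes>\<^sub>M (borel :: real measure))"
    "{(a, b). a < 0 \<or> a + b < 0} \<in> sets (borel \<Otimes>\<^sub>M (borel :: real measure))"
    "{(a, b). a < 0 \<and> a + b \<ge> 0} \<in> sets (borel \<Otimes>\<^sub>M (borel :: real measure))"
    by (simp_all add: case_prod_unfold space_pair_measure)
qed

text \<open>The quadrant where both variables are negative lies in the event, and a centred
  perturbation is negative with probability 1/2.\<close>

lemma both_negative_ge:
  "measure llr_law {..<0} / 2 \<le> measure joint_law {(a, b). a < 0 \<and> a + b < 0}"
proof -
  have "measure joint_law ({..<0} \<times> {..<0}) \<le> measure joint_law {(a, b). a < 0 \<and> a + b < 0}"
    by (intro P.finite_measure_mono) (auto simp: sets_joint_law)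
  then show ?thesis
    by (simp add: joint_Times measure_normal_law_negative[OF var_pos])
qed

text \<open>If \<open>a \<ge> -K\<close>, then \<open>a + b < 0\<close> forces \<open>b < K\<close>,
  an event of probability at most \<open>1/2 + K / sqrt s\<close>; the case \<open>a < -K\<close> is
  rare relative to \<open>a < 0\<close>. The cutoff \<open>K\<close> stays free, to be balanced
  against \<open>s\<close> later.\<close>

lemma both_negative_le:
  assumes "K \<ge> 0"
  shows "measure joint_law {(a, b). a < 0 \<and> a + b < 0}
    \<le> measure llr_law {..<0} * (1/2 + (K / sqrt s + exp (- K / 2)))"
proof -
  have "measure pert_law {..<K} \<le> measure pert_law {..<0} + measure pert_law {0..<0 + K}"
    using assms by (subst pert.finite_measure_Union[symmetric]) (auto simp: ivl_disj_un)
  also have "\<dots> \<le> 1/2 + K / sqrt s"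
    using measure_normal_law_interval_le[OF var_pos assms, of 0 0] measure_normal_law_negative[OF var_pos] by simp
  finally have pert: "measure pert_law {..<K} \<le> 1/2 + K / sqrt s" .
  have "measure joint_law {(a, b). a < 0 \<and> a + b < 0}
      \<le> measure joint_law ({..<0} \<times> {..<K} \<union> {..<-K} \<times> UNIV)"
    by (intro P.finite_measure_mono) (auto simp: sets_joint_law intro!: sets.Un)
  also have "\<dots> \<le> measure joint_law ({..<0} \<times> {..<K}) + measure joint_law ({..<-K} \<times> UNIV)"
    by (intro measure_Un_le) (auto simp: sets_joint_law)
  also have "\<dots> = measure llr_law {..<0} * measure pert_law {..<K} + measure llr_law {..<-K}"
    using pert.prob_space by (simp add: joint_Times)
  also have "\<dots> \<le> measure llr_law {..<0} * (1/2 + K / sqrt s) + exp (- K / 2) * measure llr_law {..<0}"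
    using mean_pos assms pert
    by (intro add_mono mult_left_mono measure_normal_law_shifted_tail) auto
  finally show ?thesis by (simp only: algebra_simps)
qed

text \<open>When \<open>a \<ge> m/2\<close> and \<open>b \<ge> -m/2\<close>, neither
  \<open>a\<close> nor \<open>a + b\<close> is negative. The two lower tails at distance
  \<open>m/2\<close> from their means give the two exponentials.\<close>

lemma some_negative_le:
  "measure joint_law {(a, b). a < 0 \<or> a + b < 0} \<le> exp (- m / 16) + exp (- m\<^sup>2 / (8 * s))"
proof -
  have "measure joint_law {(a, b). a < 0 \<or> a + b < 0}
      \<le> measure joint_law ({..<m/2} \<times> UNIV \<union> UNIV \<times> {..<-m/2})"
    using mean_pos by (intro P.finite_measure_mono) (auto simp: sets_joint_law intro!: sets.Un)
  also have "\<dots> \<le> measure joint_law ({..<m/2} \<times> UNIV) + measure joint_law (UNIV \<times> {..<-m/2})"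
    by (intro measure_Un_le) (auto simp: sets_joint_law)
  also have "\<dots> = measure llr_law {..<m/2} + measure pert_law {..<-m/2}"
    using pert.prob_space llr.prob_space by (simp add: joint_Times)
  also have "measure llr_law {..<m/2} \<le> exp (- (m - m/2)\<^sup>2 / (2 * (2 * m)))"
    using mean_pos by (intro measure_normal_law_lower_tail) auto
  also have "- (m - m/2)\<^sup>2 / (2 * (2 * m)) = - m / 16"
    using mean_pos by (simp add: field_simps power2_eq_square)
  also have "measure pert_law {..<-m/2} \<le> exp (- (0 - (-m/2))\<^sup>2 / (2 * s))"
    using mean_pos var_pos by (intro measure_normal_law_lower_tail) auto
  also have "- (0 - (-m/2))\<^sup>2 / (2 * s) = - m\<^sup>2 / (8 * s)"
    using var_pos by (simp add: field_simps power2_eq_square)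
  finally show ?thesis by simp
qed

lemma only_llr_negative:
  "measure joint_law {(a, b). a < 0 \<and> a + b \<ge> 0}
    = measure llr_law {..<0} - measure joint_law {(a, b). a < 0 \<and> a + b < 0}"
proof -
  have "{..<0} \<times> UNIV = {(a, b). a < 0 \<and> a + b \<ge> 0} \<union> {(a, b). a < 0 \<and> a + b < (0::real)}" by auto
  then have "measure joint_law ({..<0} \<times> UNIV) = measure joint_law {(a, b). a < 0 \<and> a + b \<ge> 0}
      + measure joint_law {(a, b). a < 0 \<and> a + b < 0}"
    by (simp only:, subst P.finite_measure_Union) (auto simp: sets_joint_law)
  then show ?thesis using pert.prob_space by (simp add: joint_Times)
qed

end

section \<open>First error positions at a fixed length\<close>

text \<open>The product form avoids dividing by the probability of \<open>E\<close>; when that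
  probability is 0, both sides vanish.\<close>

lemma (in prob_space) prob_cond_law:
  assumes law: "cond_law M E S X = Q" "prob_space Q"
    and [measurable]: "Measurable.pred M E" "X \<in> measurable M S" "B \<in> sets S"
  shows "prob {w \<in> space M. E w \<and> X w \<in> B} = prob {w \<in> space M. E w} * measure Q B"
proof (cases "prob {w \<in> space M. E w} = 0")
  case True
  have "prob {w \<in> space M. E w \<and> X w \<in> B} \<le> prob {w \<in> space M. E w}"
    by (intro finite_measure_mono) auto
  then show ?thesis using True by (simp add: measure_le_0_iff)
next
  case False
  then have "emeasure M {w \<in> space M. E w} \<noteq> 0"
    by (simp add: emeasure_eq_measure)
  moreover have "measure Q B = measure (uniform_measure M {w \<in> space M. E w}) (X -` B \<inter> space M)"
    unfolding law(1)[symmetric] cond_law_def by (subst measure_distr) auto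
  moreover have "{w \<in> space M. E w} \<inter> (X -` B \<inter> space M) = {w \<in> space M. E w \<and> X w \<in> B}" by auto
  ultimately show ?thesis using False by simp
qed

lemma first_error_eq_iff:
  "i < N \<Longrightarrow> first_error N u w = i \<longleftrightarrow> zero_before u i w \<and> u i w"
  unfolding first_error_def zero_before_def
  by (auto dest: not_less_Least intro: LeastI Least_equality not_le_imp_less) 

lemma zero_before_first_error: "zero_before u (first_error N u w) w"
  by (auto simp: first_error_def zero_before_def dest: not_less_Least)

text \<open>As \<open>i < N\<close>, the default value \<open>N\<close> of an error-free word counts
  correctly as a position after \<open>i\<close>.\<close>

lemma first_error_less_iff:
  assumes "i < N"
  shows "i < first_error N u w \<longleftrightarrow> zero_before u i w \<and> \<not> u i w"
proof
  assume "i < first_error N u w"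
  then show "zero_before u i w \<and> \<not> u i w"
    using zero_before_first_error[of u N w] by (auto simp: zero_before_def)
next
  assume *: "zero_before u i w \<and> \<not> u i w"
  have "\<not> first_error N u w \<le> i"
  proof
    assume le: "first_error N u w \<le> i"
    then have "u (first_error N u w) w"
      using first_error_eq_iff[of "first_error N u w" N u w] assms by auto
    then show False using le * by (auto simp: zero_before_def le_less)
  qed
  then show "i < first_error N u w" by simp
qed

section \<open>Both decoders at one fixed length, with arbitrary positive means and
  variances\<close>

locale decoder_pair = prob_space M for M :: "'w measure" +
  fixes N :: nat and A :: "nat set" and L P :: "nat \<Rightarrow> 'w \<Rightarrow> real" and \<mu> s :: "nat \<Rightarrow> real"
  assumes A_subset: "A \<subseteq> {..<N}"
    and L_meas [measurable]: "\<And>i. i < N \<Longrightarrow> L i \<in> borel_measurable M"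
    and P_meas [measurable]: "\<And>i. i < N \<Longrightarrow> P i \<in> borel_measurable M"
    and mean_pos: "\<And>i. i \<in> A \<Longrightarrow> \<mu> i > 0"
    and var_pos: "\<And>i. i \<in> A \<Longrightarrow> s i > 0"
    and llr_cond_law: "\<And>i. i \<in> A \<Longrightarrow>
      cond_law M (zero_before (sc_decoder A L) i) borel (L i) = normal_law (\<mu> i) (2 * \<mu> i)"
    and joint_cond_law: "\<And>i. i \<in> A \<Longrightarrow>
      cond_law M (\<lambda>w. zero_before (sc_decoder A L) i w \<and> zero_before (perturbed_decoder A L P) i w)
          (borel \<Otimes>\<^sub>M borel) (\<lambda>w. (L i w, L i w + P i w))
        = distr (normal_law (\<mu> i) (2 * \<mu> i) \<Otimes>\<^sub>M normal_law 0 (s i))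
            (borel \<Otimes>\<^sub>M borel) (\<lambda>(g1, g2). (g1, g1 + g2))"
begin

abbreviation "u0 \<equiv> sc_decoder A L"
abbreviation "u1 \<equiv> perturbed_decoder A L P"
abbreviation "both_zero i w \<equiv> zero_before u0 i w \<and> zero_before u1 i w"
abbreviation "q i \<equiv> measure (normal_law (\<mu> i) (2 * \<mu> i)) {..<0}"
abbreviation "joint i \<equiv> normal_law (\<mu> i) (2 * \<mu> i) \<Otimes>\<^sub>M normal_law 0 (s i)"

lemma perturbed_llr: "i \<in> A \<Longrightarrow> perturbed_llr (\<mu> i) (s i)"
  using mean_pos var_pos by unfold_locales

lemma finite_A: "finite A"
  using A_subset finite_subset by blast

lemma A_less: "i \<in> A \<Longrightarrow> i < N"
  using A_subset by auto

lemma u0_meas [measurable]: "Measurable.pred M (u0 i)"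
proof (cases "i \<in> A")
  case True
  then have [measurable]: "L i \<in> borel_measurable M" using A_less by auto
  have "Measurable.pred M (\<lambda>w. L i w < 0)" by measurable
  then show ?thesis using True by (simp add: sc_decoder_def[abs_def])
qed (simp add: sc_decoder_def[abs_def])

lemma u1_meas [measurable]: "Measurable.pred M (u1 i)"
proof (cases "i \<in> A")
  case True
  then have [measurable]: "L i \<in> borel_measurable M" "P i \<in> borel_measurable M" using A_less by auto
  have "Measurable.pred M (\<lambda>w. L i w + P i w < 0)" by measurable
  then show ?thesis using True by (simp add: perturbed_decoder_def[abs_def])
qed (simp add: perturbed_decoder_def[abs_def])

lemma zero_before_meas [measurable]:
  "Measurable.pred M (zero_before u0 i)" "Measurable.pred M (zero_before u1 i)"
  unfolding zero_before_def[abs_def] by measurable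

lemma prob_sc_error:
  assumes i: "i \<in> A"
  shows "prob {w \<in> space M. zero_before u0 i w \<and> L i w < 0} = prob {w \<in> space M. zero_before u0 i w} * q i"
  using prob_cond_law[OF llr_cond_law[OF i], of "{..<0}"] prob_space_normal_law mean_pos[OF i] A_less[OF i]
  by simp

text \<open>The generalized Gaussian approximation in product form: given error-free prefixes of
  both decoders, events of the pair are computed from independent Gaussians.\<close>

lemma prob_joint:
  assumes i: "i \<in> A" and [measurable]: "Measurable.pred (borel \<Otimes>\<^sub>M borel) (\<lambda>(x, y). R x y)"
  shows "prob {w \<in> space M. both_zero i w \<and> R (L i w) (L i w + P i w)}
    = prob {w \<in> space M. both_zero i w} * measure (joint i) {(a, b). R a (a + b)}"
proof -
  interpret pl: perturbed_llr "\<mu> i" "s i" by (rule perturbed_llr[OF i])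
  have [measurable]: "L i \<in> borel_measurable M" "P i \<in> borel_measurable M" using i A_less by auto
  let ?Q = "distr (joint i) (borel \<Otimes>\<^sub>M borel) (\<lambda>(g1, g2). (g1, g1 + g2))"
  have meas: "(\<lambda>(g1, g2). (g1, g1 + g2)) \<in> measurable (joint i) (borel \<Otimes>\<^sub>M (borel :: real measure))"
    by measurable
  have R: "{(x, y). R x y} \<in> sets (borel \<Otimes>\<^sub>M borel)"
    using assms(2) by (simp add: pred_def space_pair_measure)
  have "measure ?Q {(x, y). R x y} = measure (joint i) {(a, b). R a (a + b)}"
    unfolding measure_distr[OF meas R]
    by (rule arg_cong[where f = "measure (joint i)"]) (auto simp: space_pair_measure)
  moreover have "prob_space ?Q" by (rule pl.P.prob_space_distr[OF meas])
  ultimately show ?thesis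
    using prob_cond_law[OF joint_cond_law[OF i] _ _ _ R] by simp
qed

text \<open>Union bound over the first bit at which either decoder errs: there both prefixes are
  still zero, so the joint Gaussian law applies. The bound does not depend on
  \<open>i\<close>.\<close>

lemma prob_both_zero_ge:
  "1 - (\<Sum>i\<in>A. exp (- \<mu> i / 16) + exp (- (\<mu> i)\<^sup>2 / (8 * s i))) \<le> prob {w \<in> space M. both_zero i w}"
proof -
  let ?B = "\<lambda>k. {w \<in> space M. both_zero k w \<and> (L k w < 0 \<or> L k w + P k w < 0)}"
  have B_meas: "?B k \<in> sets M" if "k \<in> A" for k
  proof -
    have [measurable]: "L k \<in> borel_measurable M" "P k \<in> borel_measurable M" using that A_less by auto
    show ?thesis by measurable
  qed
  have "w \<in> (\<Union>k\<in>A. ?B k)" if w: "w \<in> space M" "\<not> both_zero i w" for w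
  proof -
    define k where "k = (LEAST k. u0 k w \<or> u1 k w)"
    have "\<exists>k. u0 k w \<or> u1 k w" using w by (auto simp: zero_before_def)
    then have "u0 k w \<or> u1 k w" unfolding k_def by (rule LeastI_ex)
    moreover have "both_zero k w" 
      by (auto simp: zero_before_def k_def dest: not_less_Least)
    ultimately show ?thesis
      using w by (auto simp: sc_decoder_def perturbed_decoder_def)
  qed
  then have "prob (space M - {w \<in> space M. both_zero i w}) \<le> prob (\<Union>k\<in>A. ?B k)"
    using B_meas finite_A by (intro finite_measure_mono) auto
  also have "\<dots> \<le> (\<Sum>k\<in>A. prob (?B k))"
    using B_meas finite_A by (intro finite_measure_subadditive_finite) auto
  also have "\<dots> \<le> (\<Sum>k\<in>A. exp (- \<mu> k / 16) + exp (- (\<mu> k)\<^sup>2 / (8 * s k)))"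
  proof (rule sum_mono)
    fix k assume k: "k \<in> A"
    interpret pl: perturbed_llr "\<mu> k" "s k" by (rule perturbed_llr[OF k])
    have "prob (?B k) = prob {w \<in> space M. both_zero k w} * measure (joint k) {(a, b). a < 0 \<or> a + b < 0}"
      by (rule prob_joint[OF k]) measurable
    also have "\<dots> \<le> measure (joint k) {(a, b). a < 0 \<or> a + b < 0}"
      by (rule mult_left_le_one_le) auto
    also note pl.some_negative_le
    finally show "prob (?B k) \<le> exp (- \<mu> k / 16) + exp (- (\<mu> k)\<^sup>2 / (8 * s k))" .
  qed
  finally show ?thesis by (subst (asm) prob_compl) auto
qed

text \<open>The events are split by the position of the first SC error, which lies in
  \<open>A\<close> because frozen bits are never wrong.\<close>

lemma prob_first_error_sum:
  assumes "\<And>i. i \<in> A \<Longrightarrow> {w \<in> space M. zero_before u0 i w \<and> L i w < 0 \<and> R w} \<in> sets M"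
  shows "prob {w \<in> space M. R w \<and> first_error N u0 w < N}
    = (\<Sum>i\<in>A. prob {w \<in> space M. zero_before u0 i w \<and> L i w < 0 \<and> R w})"
proof -
  let ?B = "\<lambda>i. {w \<in> space M. zero_before u0 i w \<and> L i w < 0 \<and> R w}"
  have B: "?B i = {w \<in> space M. R w \<and> first_error N u0 w = i}" if "i \<in> A" for i
    using that A_less[OF that] by (auto simp: first_error_eq_iff sc_decoder_def)
  have "first_error N u0 w \<in> A" if "first_error N u0 w < N" for w
    using first_error_eq_iff[OF that, of u0 w] by (auto simp: sc_decoder_def)
  then have "{w \<in> space M. R w \<and> first_error N u0 w < N} = (\<Union>i\<in>A. ?B i)"
    using A_less by (auto simp: B)
  also have "prob \<dots> = (\<Sum>i\<in>A. prob (?B i))"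
    using assms finite_A
    by (intro finite_measure_finite_Union) (auto simp: disjoint_family_on_def B)
  finally show ?thesis .
qed

text \<open>Numerator and denominator are sums over the first SC error position. They are compared
  term by term with an error relative to the term of the denominator, so the sizes of the different
  \<open>q i\<close> never have to be compared.\<close>

lemma cond_prob_first_error:
  assumes A: "A \<noteq> {}"
    and bad: "(\<Sum>i\<in>A. exp (- \<mu> i / 16) + exp (- (\<mu> i)\<^sup>2 / (8 * s i))) \<le> \<eta>" "\<eta> < 1"
    and K: "K \<ge> 0" "\<And>i. i \<in> A \<Longrightarrow> K / sqrt (s i) + exp (- K / 2) \<le> \<epsilon>"
  shows "\<bar>\<P>(w in M. first_error N u1 w > first_error N u0 w \<bar> first_error N u0 w < N) - 1/2\<bar> \<le> \<epsilon> + \<eta>"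
    and "\<bar>\<P>(w in M. first_error N u1 w = first_error N u0 w \<bar> first_error N u0 w < N) - 1/2\<bar> \<le> \<epsilon> + \<eta>"
proof -
  define e where "e i = prob {w \<in> space M. zero_before u0 i w}" for i
  define b where "b i = prob {w \<in> space M. both_zero i w}" for i
  define p where "p i = measure (joint i) {(a, b). a < 0 \<and> a + b < 0}" for i
  have b_ge: "1 - \<eta> \<le> b i" for i
    using prob_both_zero_ge[of i] bad by (simp add: b_def)
  have be: "b i \<le> e i" "e i \<le> 1" for i
    unfolding b_def e_def by (auto intro!: finite_measure_mono)
  have \<eta>: "0 \<le> \<eta>" using order_trans[OF sum_nonneg bad(1)] by auto
  have \<epsilon>: "0 \<le> \<epsilon>"
  proof -
    obtain i where i: "i \<in> A" using A by auto
    have "0 \<le> K / sqrt (s i) + exp (- K / 2)" using K(1) var_pos[OF i] by auto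
    then show ?thesis using K(2)[OF i] by linarith
  qed
  have p: "q i / 2 \<le> p i" "p i \<le> q i * (1/2 + \<epsilon>)" "0 < q i" if i: "i \<in> A" for i
  proof -
    interpret pl: perturbed_llr "\<mu> i" "s i" by (rule perturbed_llr[OF i])
    show "0 < q i" using mean_pos[OF i] by (intro measure_normal_law_pos) auto
    show "q i / 2 \<le> p i" unfolding p_def by (rule pl.both_negative_ge)
    have "p i \<le> q i * (1/2 + (K / sqrt (s i) + exp (- K / 2)))"
      unfolding p_def using K(1) by (rule pl.both_negative_le)
    also have "\<dots> \<le> q i * (1/2 + \<epsilon>)" using K(2)[OF i] by (intro mult_left_mono) auto
    finally show "p i \<le> q i * (1/2 + \<epsilon>)" .
  qed
  have D: "prob {w \<in> space M. first_error N u0 w < N} = (\<Sum>i\<in>A. e i * q i)"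
    using prob_first_error_sum[of "\<lambda>_. True"] L_meas A_less by (simp add: prob_sc_error e_def)
  have D_pos: "(\<Sum>i\<in>A. e i * q i) > 0"
  proof (intro sum_pos mult_pos_pos)
    show "0 < e i" for i using b_ge[of i] be(1)[of i] bad(2) by linarith
  qed (use A finite_A p(3) in auto)
  \<comment> \<open>Both claims are instances: \<open>r i\<close> is \<open>q i - p i\<close> for a
    later perturbed error and \<open>p i\<close> for a simultaneous one.\<close>
  have estimate: "\<bar>x / (\<Sum>i\<in>A. e i * q i) - 1/2\<bar> \<le> \<epsilon> + \<eta>"
    if x: "x = (\<Sum>i\<in>A. b i * r i)" and r: "\<And>i. i \<in> A \<Longrightarrow> q i * (1/2 - \<epsilon>) \<le> r i" 
      "\<And>i. i \<in> A \<Longrightarrow> r i \<le> q i * (1/2 + \<epsilon>)" "\<And>i. i \<in> A \<Longrightarrow> 0 \<le> r i" "\<And>i. i \<in> A \<Longrightarrow> r i \<le> q i" for x r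
  proof -
    have summand: "\<bar>b i * r i - e i * q i / 2\<bar> \<le> (\<epsilon> + \<eta>) * (e i * q i)" if i: "i \<in> A" for i
    proof -
      have e0: "0 \<le> e i" "0 \<le> b i" by (simp_all add: e_def b_def)
      have "b i * r i \<le> e i * r i" using be r(3)[OF i] by (intro mult_right_mono)
      also have "\<dots> \<le> e i * (q i * (1/2 + \<epsilon>))" using e0 r(2)[OF i] by (intro mult_left_mono)
      finally have up: "b i * r i - e i * q i / 2 \<le> \<epsilon> * (e i * q i)" by (simp add: algebra_simps)
      \<comment> \<open>The absolute bound \<open>1 - \<eta> \<le> b i\<close> becomes relative to
        \<open>e i\<close> because \<open>e i \<le> 1\<close>.\<close>
      have "e i * (1 - \<eta>) \<le> 1 * (1 - \<eta>)" using be bad(2) by (intro mult_right_mono) auto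
      then have "e i - b i \<le> \<eta> * e i" using b_ge[of i] by (simp add: algebra_simps)
      then have "(e i - b i) * r i \<le> \<eta> * e i * q i"
        using r(3,4)[OF i] \<eta> e0 by (intro mult_mono) auto
      moreover have "e i * (q i * (1/2 - \<epsilon>)) \<le> e i * r i" using e0 r(1)[OF i] by (intro mult_left_mono)
      ultimately have low: "e i * q i / 2 - b i * r i \<le> (\<epsilon> + \<eta>) * (e i * q i)" by (simp add: algebra_simps)
      have "0 \<le> \<eta> * (e i * q i)" using \<eta> e0 by auto
      then show ?thesis using up low by (simp add: abs_le_iff algebra_simps)
    qed
    have "\<bar>x - (\<Sum>i\<in>A. e i * q i) / 2\<bar> = \<bar>\<Sum>i\<in>A. b i * r i - e i * q i / 2\<bar>"
      by (simp add: x sum_subtractf sum_divide_distrib)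
    also have "\<dots> \<le> (\<epsilon> + \<eta>) * (\<Sum>i\<in>A. e i * q i)"
      unfolding sum_distrib_left by (rule order_trans[OF sum_abs sum_mono]) (rule summand)
    finally have "\<bar>x - (\<Sum>i\<in>A. e i * q i) / 2\<bar> \<le> (\<epsilon> + \<eta>) * (\<Sum>i\<in>A. e i * q i)" .
    moreover have "x / (\<Sum>i\<in>A. e i * q i) - 1/2 = (x - (\<Sum>i\<in>A. e i * q i) / 2) / (\<Sum>i\<in>A. e i * q i)"
      using D_pos by (simp add: diff_divide_distrib)
    ultimately show ?thesis
      using D_pos by (simp only: abs_divide abs_of_pos pos_divide_le_eq)
  qed
  let ?gt = "\<lambda>w. first_error N u1 w > first_error N u0 w"
  let ?eq = "\<lambda>w. first_error N u1 w = first_error N u0 w"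
  \<comment> \<open>Once the first SC error is at \<open>i\<close>, a later perturbed error means a
    zero prefix and no error at \<open>i\<close> itself; equality means a zero prefix and an error
    at \<open>i\<close>.\<close>
  have gt: "{w \<in> space M. zero_before u0 i w \<and> L i w < 0 \<and> ?gt w}
      = {w \<in> space M. both_zero i w \<and> (L i w < 0 \<and> L i w + P i w \<ge> 0)}"
    and eq: "{w \<in> space M. zero_before u0 i w \<and> L i w < 0 \<and> ?eq w}
      = {w \<in> space M. both_zero i w \<and> (L i w < 0 \<and> L i w + P i w < 0)}" if i: "i \<in> A" for i
  proof -
    have "(?gt w \<longleftrightarrow> zero_before u1 i w \<and> L i w + P i w \<ge> 0) \<and>
        (?eq w \<longleftrightarrow> zero_before u1 i w \<and> L i w + P i w < 0)"
      if "zero_before u0 i w" "L i w < 0" for w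
    proof -
      have eq: "first_error N u0 w = i"
        using that i A_less[OF i] by (simp add: first_error_eq_iff sc_decoder_def)
      show ?thesis
        unfolding eq using i by (auto simp: first_error_eq_iff[OF A_less[OF i]] first_error_less_iff[OF A_less[OF i]]
            perturbed_decoder_def)
    qed
    then show
      "{w \<in> space M. zero_before u0 i w \<and> L i w < 0 \<and> ?gt w}
        = {w \<in> space M. both_zero i w \<and> (L i w < 0 \<and> L i w + P i w \<ge> 0)}"
      "{w \<in> space M. zero_before u0 i w \<and> L i w < 0 \<and> ?eq w}
        = {w \<in> space M. both_zero i w \<and> (L i w < 0 \<and> L i w + P i w < 0)}"
      by blast+
  qed
  have meas: "{w \<in> space M. both_zero i w \<and> (L i w < 0 \<and> L i w + P i w \<ge> 0)} \<in> sets M"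
    "{w \<in> space M. both_zero i w \<and> (L i w < 0 \<and> L i w + P i w < 0)} \<in> sets M" if "i \<in> A" for i
  proof -
    have [measurable]: "L i \<in> borel_measurable M" "P i \<in> borel_measurable M" using that A_less by auto
    show "{w \<in> space M. both_zero i w \<and> (L i w < 0 \<and> L i w + P i w \<ge> 0)} \<in> sets M"
      "{w \<in> space M. both_zero i w \<and> (L i w < 0 \<and> L i w + P i w < 0)} \<in> sets M" by measurable
  qed
  have gt_prob: "prob {w \<in> space M. ?gt w \<and> first_error N u0 w < N} = (\<Sum>i\<in>A. b i * (q i - p i))"
  proof (subst prob_first_error_sum)
    show "(\<Sum>i\<in>A. prob {w \<in> space M. zero_before u0 i w \<and> L i w < 0 \<and> ?gt w}) = (\<Sum>i\<in>A. b i * (q i - p i))"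
    proof (rule sum.cong)
      fix i assume i: "i \<in> A"
      interpret pl: perturbed_llr "\<mu> i" "s i" by (rule perturbed_llr[OF i])
      show "prob {w \<in> space M. zero_before u0 i w \<and> L i w < 0 \<and> ?gt w} = b i * (q i - p i)"
        unfolding gt[OF i] b_def p_def pl.only_llr_negative[symmetric]
        by (rule prob_joint[OF i]) measurable
    qed simp
  qed (simp only: gt meas)
  have eq_prob: "prob {w \<in> space M. ?eq w \<and> first_error N u0 w < N} = (\<Sum>i\<in>A. b i * p i)"
  proof (subst prob_first_error_sum)
    show "(\<Sum>i\<in>A. prob {w \<in> space M. zero_before u0 i w \<and> L i w < 0 \<and> ?eq w}) = (\<Sum>i\<in>A. b i * p i)"
    proof (rule sum.cong)
      fix i assume i: "i \<in> A"
      show "prob {w \<in> space M. zero_before u0 i w \<and> L i w < 0 \<and> ?eq w} = b i * p i"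
        unfolding eq[OF i] b_def p_def by (rule prob_joint[OF i]) measurable
    qed simp
  qed (simp only: eq meas)
  have p_le: "p i \<le> q i" if i: "i \<in> A" for i
  proof -
    interpret pl: perturbed_llr "\<mu> i" "s i" by (rule perturbed_llr[OF i])
    show ?thesis
      using pl.only_llr_negative measure_nonneg[of "joint i" "{(a, b). a < 0 \<and> a + b \<ge> 0}"]
      by (simp add: p_def)
  qed
  have q\<epsilon>: "0 \<le> q i * \<epsilon>" for i using \<epsilon> by simp
  have p_nonneg: "0 \<le> p i" for i by (simp add: p_def)
  show "\<bar>\<P>(w in M. ?gt w \<bar> first_error N u0 w < N) - 1/2\<bar> \<le> \<epsilon> + \<eta>"
    unfolding cond_prob_def D
  proof (rule estimate[OF gt_prob])
    fix i assume i: "i \<in> A"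
    show "q i * (1/2 - \<epsilon>) \<le> q i - p i" "q i - p i \<le> q i * (1/2 + \<epsilon>)"
      using p[OF i] q\<epsilon>[of i] by (auto simp: algebra_simps)
    show "0 \<le> q i - p i" "q i - p i \<le> q i" using p_le[OF i] p_nonneg[of i] by auto
  qed
  show "\<bar>\<P>(w in M. ?eq w \<bar> first_error N u0 w < N) - 1/2\<bar> \<le> \<epsilon> + \<eta>"
    unfolding cond_prob_def D
  proof (rule estimate[OF eq_prob])
    fix i assume i: "i \<in> A"
    show "q i * (1/2 - \<epsilon>) \<le> p i" using p[OF i] q\<epsilon>[of i] by (auto simp: algebra_simps)
  qed (use p p_le p_nonneg in auto)
qed

end

section \<open>The limit\<close>

text \<open>With \<open>S = c * x powr \<delta>\<close> and cutoff \<open>S powr (1/4)\<close>, the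
  first summand is \<open>S powr (-1/4)\<close>, while the cutoff itself still tends to
  infinity.\<close>

lemma perturbation_error_tendsto_0:
  fixes c \<delta> :: real
  assumes "c > 0" "\<delta> > 0"
  shows "((\<lambda>x::real. (c * x powr \<delta>) powr (1/4) / sqrt (c * x powr \<delta>)
      + exp (- ((c * x powr \<delta>) powr (1/4)) / 2)) \<longlongrightarrow> 0) at_top"
  using assms by real_asymp

lemma union_bound_tendsto_0:
  fixes \<delta> \<delta>' :: real
  assumes "\<delta> > 0" "\<delta>' > 0"
  shows "((\<lambda>x::real. x * (exp (- (x powr \<delta>) / 16) + exp (- (x powr \<delta>') / 16))) \<longlongrightarrow> 0) at_top"
proof -
  have "((\<lambda>x::real. x * exp (- (x powr d) / 16)) \<longlongrightarrow> 0) at_top" if "d > 0" for d :: real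
    using that by real_asymp
  from tendsto_add_zero[OF this[OF assms(1)] this[OF assms(2)]]
  show ?thesis by (simp only: distrib_left)
qed

theorem theorem1:
  fixes v \<alpha> \<beta> :: real
    and vp :: "nat \<Rightarrow> real"
    and A :: "nat \<Rightarrow> nat set"
    and M :: "nat \<Rightarrow> 'w measure"
    and L P :: "nat \<Rightarrow> nat \<Rightarrow> 'w \<Rightarrow> real"
    and u0 u1 :: "nat \<Rightarrow> nat \<Rightarrow> 'w \<Rightarrow> bool"
    and \<tau>0 \<tau>1 :: "nat \<Rightarrow> 'w \<Rightarrow> nat"
  assumes noise_var: "v > 0"
    and beta: "1/3 < \<beta>" "\<beta> < 1/2"
    and alpha: "1 - 2 * \<beta> < \<alpha>" "\<alpha> < \<beta>"
    and pert_power_pos: "\<And>n. vp n > 0"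
    and pert_power: "(\<lambda>n. vp n * (2 ^ n) powr \<alpha>) \<longlonglongrightarrow> 1"
    and info_nonempty: "\<forall>\<^sub>F n in sequentially. A n \<noteq> {}"
    and info_set: "\<And>n. A n \<subseteq>
      {i. i < 2 ^ n \<and> bhattacharyya (bit_channel (bi_awgn v) n i) < 2 powr (- ((2 ^ n) powr \<beta>))}"
    and mean_bound: "\<And>n i. i \<in> A n \<Longrightarrow> llr_mean v n i \<ge> (2 ^ n) powr \<beta>"
    and prob: "\<And>n. prob_space (M n)"
    and L_meas: "\<And>n i. i < 2 ^ n \<Longrightarrow> L n i \<in> borel_measurable (M n)"
    and P_meas: "\<And>n i. i < 2 ^ n \<Longrightarrow> P n i \<in> borel_measurable (M n)"
    and P_law: "\<And>n i. i < 2 ^ n \<Longrightarrow> distr (M n) borel (P n i) = normal_law 0 (pert_var (vp n) i)"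
    and u0_def: "\<And>n. u0 n = sc_decoder (A n) (L n)"
    and u1_def: "\<And>n. u1 n = perturbed_decoder (A n) (L n) (P n)"
    and \<tau>0_def: "\<And>n. \<tau>0 n = first_error (2 ^ n) (u0 n)"
    and \<tau>1_def: "\<And>n. \<tau>1 n = first_error (2 ^ n) (u1 n)"
    and gaussian_approx: "\<And>n i. i \<in> A n \<Longrightarrow>
      cond_law (M n) (zero_before (u0 n) i) borel (L n i)
        = normal_law (llr_mean v n i) (2 * llr_mean v n i)"
    and generalized_gaussian_approx: "\<And>n i. i \<in> A n \<Longrightarrow>
      cond_law (M n) (\<lambda>w. zero_before (u0 n) i w \<and> zero_before (u1 n) i w)
          (borel \<Otimes>\<^sub>M borel) (\<lambda>w. (L n i w, L n i w + P n i w))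
        = distr (normal_law (llr_mean v n i) (2 * llr_mean v n i)
                  \<Otimes>\<^sub>M normal_law 0 (pert_var (vp n) i))
            (borel \<Otimes>\<^sub>M borel) (\<lambda>(g1, g2). (g1, g1 + g2))"
    and weak_dependence: "\<forall>\<^sub>F n in sequentially. \<forall>i\<in>A n. \<forall>j\<in>A n. j < i \<longrightarrow> (\<forall>B\<in>sets borel.
      \<bar>\<P>(w in M n. L n i w \<in> B \<bar> zero_before (u0 n) i w \<and> zero_before (u1 n) j w)
        - \<P>(w in M n. L n i w \<in> B \<bar> zero_before (u0 n) i w)\<bar> < 2 powr (- ((2 ^ n) powr \<beta>)))"
  shows "(\<lambda>n. \<P>(w in M n. \<tau>1 n w > \<tau>0 n w \<bar> \<tau>0 n w < 2 ^ n)) \<longlonglongrightarrow> 1/2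
       \<and> (\<lambda>n. \<P>(w in M n. \<tau>1 n w = \<tau>0 n w \<bar> \<tau>0 n w < 2 ^ n)) \<longlonglongrightarrow> 1/2"
proof -
  define x :: "nat \<Rightarrow> real" where "x n = 2 ^ n" for n
  \<comment> \<open>One factor \<open>v / 2\<close> inverts the initial mean \<open>2 / v\<close>;
    the other factor 1/2 comes from the lower bound on \<open>vp n\<close>.\<close>
  define c where "c = v / 4"
  define S where "S n = c * x n powr (\<beta> - \<alpha>)" for n
  define K where "K n = S n powr (1/4)" for n
  define \<epsilon> where "\<epsilon> n = K n / sqrt (S n) + exp (- K n / 2)" for n
  \<comment> \<open>The factor \<open>x n\<close> bounds the size of \<open>A n\<close>. The second
    exponent is that of \<mu>^2 / s, with \<mu> at least \<open>x n powr \<beta>\<close> and s at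
    most of order \<open>x n powr (1 - \<alpha>)\<close>.\<close>
  define \<eta> where "\<eta> n = x n * (exp (- (x n powr \<beta>) / 16) + exp (- (x n powr (2 * \<beta> - 1 + \<alpha>)) / 16))" for n
  have x_top: "filterlim x at_top sequentially" unfolding x_def by real_asymp
  have c: "c > 0" using noise_var by (simp add: c_def)
  \<comment> \<open>The condition \<open>\<alpha> < \<beta>\<close> enters here: it makes
    \<open>S n\<close> tend to infinity.\<close>
  have \<epsilon>: "\<epsilon> \<longlonglongrightarrow> 0"
    using filterlim_compose[OF perturbation_error_tendsto_0 x_top, of c "\<beta> - \<alpha>"] c alpha
    by (simp add: \<epsilon>_def[abs_def] K_def S_def)
  \<comment> \<open>The condition \<open>1 - 2 * \<beta> < \<alpha>\<close> enters here: it makes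
    the second exponent positive.\<close>
  have \<eta>: "\<eta> \<longlonglongrightarrow> 0"
    using filterlim_compose[OF union_bound_tendsto_0 x_top, of \<beta> "2 * \<beta> - 1 + \<alpha>"] alpha beta
    by (simp add: \<eta>_def[abs_def])
  have lim: "f \<longlonglongrightarrow> 1/2" if "\<forall>\<^sub>F n in sequentially. \<bar>f n - 1/2\<bar> \<le> \<epsilon> n + \<eta> n" for f :: "nat \<Rightarrow> real"
  proof -
    have "(\<lambda>n. f n - 1/2) \<longlonglongrightarrow> 0"
      by (rule Lim_null_comparison[OF _ tendsto_add_zero[OF \<epsilon> \<eta>]]) (use that in simp)
    then show ?thesis by (rule LIM_zero_cancel)
  qed
  have ev_vp: "\<forall>\<^sub>F n in sequentially. 1/2 < vp n * x n powr \<alpha> \<and> vp n * x n powr \<alpha> < 2"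
    unfolding x_def
    by (intro eventually_conj order_tendstoD(1)[OF pert_power] order_tendstoD(2)[OF pert_power]) auto
  \<comment> \<open>Below 1, \<open>\<eta> n\<close> keeps the error-free prefixes at positive
    probability, so the conditioning event is not null.\<close>
  have ev_\<eta>: "\<forall>\<^sub>F n in sequentially. \<eta> n < 1"
    using order_tendstoD(2)[OF \<eta>, of 1] by simp
  have "\<forall>\<^sub>F n in sequentially.
     \<bar>\<P>(w in M n. \<tau>1 n w > \<tau>0 n w \<bar> \<tau>0 n w < 2 ^ n) - 1/2\<bar> \<le> \<epsilon> n + \<eta> n \<and>
     \<bar>\<P>(w in M n. \<tau>1 n w = \<tau>0 n w \<bar> \<tau>0 n w < 2 ^ n) - 1/2\<bar> \<le> \<epsilon> n + \<eta> n"
    using ev_vp ev_\<eta> info_nonempty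
  proof eventually_elim
    case (elim n)
    define \<mu> where "\<mu> = llr_mean v n"
    define s where "s = pert_var (vp n)"
    have A_less: "i < 2 ^ n" if "i \<in> A n" for i using info_set[of n] that by auto
    have x: "x n > 0" by (simp add: x_def)
    have \<mu>: "x n powr \<beta> \<le> \<mu> i" "0 < \<mu> i" if "i \<in> A n" for i
      using mean_bound[OF that] llr_mean_bounds[OF noise_var, of n i] by (auto simp: \<mu>_def x_def)
    have s_pos: "s i > 0" for i
      using pert_power_pos[of n] by (simp add: s_def pert_var_def)
    have vp: "x n powr (- \<alpha>) / 2 \<le> vp n" "vp n \<le> 2 * x n powr (- \<alpha>)"
      using elim(1) x by (auto simp: powr_minus field_simps)
    have s_ge: "S n \<le> s i" if i: "i \<in> A n" for i
    proof -
      have "x n powr \<beta> \<le> 2 ^ ones i * (2 / v)"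
        using \<mu>(1)[OF i] llr_mean_bounds[OF noise_var, of n i] by (simp add: \<mu>_def)
      then have "v / 2 * x n powr \<beta> \<le> 2 ^ ones i"
        using noise_var by (simp add: field_simps)
      then have "(v / 2 * x n powr \<beta>) * (x n powr (- \<alpha>) / 2) \<le> 2 ^ ones i * vp n"
        using vp(1) noise_var by (intro mult_mono) auto
      moreover have "x n powr (\<beta> - \<alpha>) = x n powr \<beta> * x n powr (- \<alpha>)"
        by (simp flip: powr_add)
      ultimately show ?thesis by (simp add: S_def c_def s_def pert_var_def)
    qed
    have s_le: "s i \<le> 2 * x n powr (1 - \<alpha>)" if i: "i \<in> A n" for i
    proof -
      have "(2::real) ^ ones i \<le> x n"
        unfolding x_def using ones_le[OF A_less[OF i]] by (intro power_increasing) auto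
      then have "s i \<le> x n * (2 * x n powr (- \<alpha>))"
        unfolding s_def pert_var_def using vp(2) x pert_power_pos[of n] by (intro mult_mono) auto
      moreover have "x n powr (1 - \<alpha>) = x n * x n powr (- \<alpha>)"
        using x powr_add[of "x n" 1 "- \<alpha>"] by simp
      ultimately show ?thesis by simp
    qed
    interpret decoder_pair "M n" "2 ^ n" "A n" "L n" "P n" \<mu> s
    proof (intro decoder_pair.intro decoder_pair_axioms.intro prob)
      show "A n \<subseteq> {..<2 ^ n}" using A_less by auto
    qed (use L_meas P_meas \<mu>(2) s_pos gaussian_approx[of _ n] generalized_gaussian_approx[of _ n]
        in \<open>auto simp: \<mu>_def s_def u0_def u1_def\<close>)
    have S: "S n > 0" using c x by (simp add: S_def)
    have bad: "(\<Sum>i\<in>A n. exp (- \<mu> i / 16) + exp (- (\<mu> i)\<^sup>2 / (8 * s i))) \<le> \<eta> n"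
    proof -
      let ?b = "exp (- (x n powr \<beta>) / 16) + exp (- (x n powr (2 * \<beta> - 1 + \<alpha>)) / 16)"
      have "exp (- \<mu> i / 16) + exp (- (\<mu> i)\<^sup>2 / (8 * s i)) \<le> ?b" if i: "i \<in> A n" for i
      proof -
        \<comment> \<open>The 16 is the 8 of the tail bound times the 2 in the upper bound for
          \<open>s i\<close>.\<close>
        have "x n powr (2 * \<beta> - 1 + \<alpha>) / 16 = (x n powr \<beta>)\<^sup>2 / (8 * (2 * x n powr (1 - \<alpha>)))"
          using x by (simp add: powr_diff powr_add powr_power field_simps)
        also have "\<dots> \<le> (\<mu> i)\<^sup>2 / (8 * s i)"
          using \<mu>[OF i] s_le[OF i] s_pos[of i] by (intro frac_le power_mono) auto
        finally show ?thesis using \<mu>(1)[OF i] by (intro add_mono) auto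
      qed
      then have "(\<Sum>i\<in>A n. exp (- \<mu> i / 16) + exp (- (\<mu> i)\<^sup>2 / (8 * s i))) \<le> (\<Sum>i\<in>A n. ?b)"
        by (rule sum_mono)
      also have "\<dots> = real (card (A n)) * ?b" by simp
      also have "\<dots> \<le> x n * ?b"
      proof (rule mult_right_mono)
        have "card (A n) \<le> 2 ^ n"
          using card_mono[of "{..<2 ^ n}" "A n"] A_less by auto
        then have "real (card (A n)) \<le> real (2 ^ n)" by (rule of_nat_mono)
        then show "real (card (A n)) \<le> x n" by (simp add: x_def)
      qed (simp add: add_nonneg_nonneg)
      finally show ?thesis by (simp add: \<eta>_def)
    qed
    have "K n / sqrt (s i) + exp (- K n / 2) \<le> \<epsilon> n" if i: "i \<in> A n" for i
      using s_ge[OF i] S unfolding \<epsilon>_def by (intro add_right_mono divide_left_mono) (auto simp: K_def s_pos)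
    then show ?case
      using cond_prob_first_error[of "\<eta> n" "K n" "\<epsilon> n"] elim bad
      by (simp add: \<tau>0_def \<tau>1_def u0_def u1_def K_def)
  qed
  then show ?thesis by (auto intro!: lim elim: eventually_mono)
qed

end
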